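(* Let $G$ be a connected self-contained graph. If $\mathrm{Fnd}(G)=\emptyset$ (the null graph), then $G$ contains a ray.
   Context: All graphs are simple; $\emptyset$ denotes the null graph (no vertices). A ray is a one-way infinite path. A self-contained graph is an infinite graph which is isomorphic to one of its proper induced subgraphs. For an induced subgraph $H$ of $G$, $G \setminus H$ denotes $G[V(G)\setminus V(H)]$. For a self-contained graph $G$, a removable subgraph of $G$ is a proper induced subgraph $H$ of $G$ with $V(H)\neq\emptyset$ such that $G\setminus H \cong G$; $\mathrm{Rem}(G)$ is the set of removable subgraphs. The foundation $\mathrm{Fnd}(G)=\bigcap_{H\in\mathrm{Rem}(G)} G\setminus H$ is the induced subgraph of $G$ on the vertices lying in no removable subgraph of $G$. *)

theory Defs
  imports Main
begin

record 'a graph =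
  verts :: "'a set"
  edges :: "'a set set"

definition simple_graph :: "'a graph \<Rightarrow> bool" where
  "simple_graph G \<longleftrightarrow>
     (\<forall>e \<in> edges G. \<exists>u \<in> verts G. \<exists>v \<in> verts G. u \<noteq> v \<and> e = {u, v})"

definition null_graph :: "'a graph" where
  "null_graph = \<lparr>verts = {}, edges = {}\<rparr>"

definition induced :: "'a graph \<Rightarrow> 'a set \<Rightarrow> 'a graph" where
  "induced G S = \<lparr>verts = verts G \<inter> S, edges = {e \<in> edges G. e \<subseteq> S}\<rparr>"

definition induced_subgraph :: "'a graph \<Rightarrow> 'a graph \<Rightarrow> bool" where
  "induced_subgraph H G \<longleftrightarrow> verts H \<subseteq> verts G \<and> H = induced G (verts H)"

definition proper_induced_subgraph :: "'a graph \<Rightarrow> 'a graph \<Rightarrow> bool" where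
  "proper_induced_subgraph H G \<longleftrightarrow> induced_subgraph H G \<and> H \<noteq> G"

definition graph_minus :: "'a graph \<Rightarrow> 'a graph \<Rightarrow> 'a graph" where
  "graph_minus G H = induced G (verts G - verts H)"

definition graph_iso :: "'a graph \<Rightarrow> 'b graph \<Rightarrow> bool" where
  "graph_iso G H \<longleftrightarrow>
     (\<exists>f. bij_betw f (verts G) (verts H) \<and>
        (\<forall>u \<in> verts G. \<forall>v \<in> verts G. {u, v} \<in> edges G \<longleftrightarrow> {f u, f v} \<in> edges H))"

definition self_contained :: "'a graph \<Rightarrow> bool" where
  "self_contained G \<longleftrightarrow>
     infinite (verts G) \<and> (\<exists>H. proper_induced_subgraph H G \<and> graph_iso G H)"

definition Rem :: "'a graph \<Rightarrow> 'a graph set" where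
  "Rem G = {H. proper_induced_subgraph H G \<and> verts H \<noteq> {} \<and> graph_iso (graph_minus G H) G}"

definition Fnd :: "'a graph \<Rightarrow> 'a graph" where
  "Fnd G = induced G (\<Inter>H \<in> Rem G. verts (graph_minus G H))"

text \<open>A finite path is given by its list of successive vertices, a ray by its injective
  sequence of successive vertices; neither is required to be induced.\<close>

definition is_path :: "'a graph \<Rightarrow> 'a list \<Rightarrow> bool" where
  "is_path G p \<longleftrightarrow> p \<noteq> [] \<and> set p \<subseteq> verts G \<and> distinct p \<and>
     (\<forall>i. Suc i < length p \<longrightarrow> {p ! i, p ! Suc i} \<in> edges G)"

definition connected_graph :: "'a graph \<Rightarrow> bool" where
  "connected_graph G \<longleftrightarrow> verts G \<noteq> {} \<and>
     (\<forall>u \<in> verts G. \<forall>v \<in> verts G. \<exists>p. is_path G p \<and> hd p = u \<and> last p = v)"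

definition is_ray :: "'a graph \<Rightarrow> (nat \<Rightarrow> 'a) \<Rightarrow> bool" where
  "is_ray G r \<longleftrightarrow> inj r \<and> range r \<subseteq> verts G \<and> (\<forall>n. {r n, r (Suc n)} \<in> edges G)"

end

theory Submission imports Defs begin

text \<open>
  Every vertex is missed by some self-embedding of \<open>G\<close>. If \<open>f\<close> misses a vertex of a finite
  set \<open>T\<close>, then the preimage of \<open>T\<close> under \<open>f\<close> is smaller than \<open>T\<close>, so by induction on the
  cardinality every finite set of vertices is missed by a self-embedding. A ray is then built
  greedily, keeping a connected set \<open>X\<close> that contains a copy of \<open>G\<close> and the current end \<open>v\<close>
  of the ray: some copy of \<open>G\<close> inside \<open>X\<close> avoids \<open>v\<close>, it lies in one component of \<open>X - {v}\<close>,
  and that component contains a neighbour of \<open>v\<close>, the next vertex of the ray.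
\<close>

definition adj_on :: "'a graph \<Rightarrow> 'a set \<Rightarrow> ('a \<times> 'a) set" where
  "adj_on G X = {(u, v). u \<in> X \<and> v \<in> X \<and> {u, v} \<in> edges G}"

text \<open>Embeddings need not be induced: the proof only uses that adjacency is preserved.\<close>

definition self_embedding :: "'a graph \<Rightarrow> ('a \<Rightarrow> 'a) \<Rightarrow> bool" where
  "self_embedding G f \<longleftrightarrow> f ` verts G \<subseteq> verts G \<and> inj_on f (verts G) \<and>
     (\<forall>u \<in> verts G. \<forall>v \<in> verts G. {u, v} \<in> edges G \<longrightarrow> {f u, f v} \<in> edges G)"

lemma self_embedding_id: "self_embedding G id"
  by (simp add: self_embedding_def)

lemma self_embedding_comp:
  assumes "self_embedding G f" "self_embedding G g"
  shows "self_embedding G (f \<circ> g)"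
proof -
  have "inj_on (f \<circ> g) (verts G)"
    using assms by (auto simp: self_embedding_def intro: comp_inj_on inj_on_subset)
  with assms show ?thesis by (simp add: self_embedding_def image_subset_iff)
qed

text \<open>Walks are mapped to walks, so the copy of a connected \<open>G\<close> lies in a single
  component of any \<open>X\<close> that contains it.\<close>

lemma adj_on_rtrancl_image:
  assumes "(u, v) \<in> (adj_on G (verts G))\<^sup>*" "self_embedding G f" "f ` verts G \<subseteq> X"
  shows "(f u, f v) \<in> (adj_on G X)\<^sup>*"
  using assms(1)
proof (induction rule: rtrancl_induct)
  case (step y z)
  then have "(f y, f z) \<in> adj_on G X"
    using assms(2,3) by (auto simp: adj_on_def self_embedding_def)
  with step.IH show ?case by (rule rtrancl_into_rtrancl)
qed simp

lemma connected_graph_rtrancl: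
  assumes "connected_graph G" "u \<in> verts G" "v \<in> verts G"
  shows "(u, v) \<in> (adj_on G (verts G))\<^sup>*"
proof -
  obtain p where p: "is_path G p" "hd p = u" "last p = v"
    using assms by (auto simp: connected_graph_def)
  have "(p ! 0, p ! i) \<in> (adj_on G (verts G))\<^sup>*" if "i < length p" for i
    using that
  proof (induction i)
    case (Suc i)
    then have "(p ! i, p ! Suc i) \<in> adj_on G (verts G)"
      using p(1) nth_mem[of i p] nth_mem[of "Suc i" p]
      by (auto simp: is_path_def adj_on_def)
    with Suc show ?case by (auto intro: rtrancl_into_rtrancl)
  qed simp
  from this[of "length p - 1"] show ?thesis
    using p by (auto simp: is_path_def hd_conv_nth last_conv_nth)
qed

text \<open>As the foundation is empty, \<open>x\<close> lies in some removable \<open>H\<close>.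
  The inverse of an isomorphism from \<open>graph_minus G H\<close> onto \<open>G\<close> embeds
  \<open>G\<close> into the complement of \<open>H\<close>.\<close>

lemma Fnd_null_missed:
  assumes "Fnd G = null_graph" "x \<in> verts G"
  shows "\<exists>f. self_embedding G f \<and> x \<notin> f ` verts G"
proof -
  have "verts (Fnd G) = {}"
    using assms(1) by (simp add: null_graph_def)
  then obtain H where H: "H \<in> Rem G" "x \<notin> verts (graph_minus G H)"
    using assms(2) by (auto simp: Fnd_def induced_def)
  then obtain f where f: "bij_betw f (verts (graph_minus G H)) (verts G)"
    and e: "\<And>u v. u \<in> verts (graph_minus G H) \<Longrightarrow> v \<in> verts (graph_minus G H) \<Longrightarrow>
      {u, v} \<in> edges (graph_minus G H) \<longleftrightarrow> {f u, f v} \<in> edges G"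
    by (auto simp: Rem_def graph_iso_def)
  define g where "g = inv_into (verts (graph_minus G H)) f"
  have g: "bij_betw g (verts G) (verts (graph_minus G H))"
    unfolding g_def by (rule bij_betw_inv_into[OF f])
  have fg: "f (g u) = u" if "u \<in> verts G" for u
    using f that unfolding g_def by (rule bij_betw_inv_into_right)
  have sub: "verts (graph_minus G H) \<subseteq> verts G" "edges (graph_minus G H) \<subseteq> edges G"
    by (auto simp: graph_minus_def induced_def)
  have "{g u, g v} \<in> edges G"
    if "u \<in> verts G" "v \<in> verts G" "{u, v} \<in> edges G" for u v
    using e[of "g u" "g v"] g that sub(2) by (auto simp: fg dest: bij_betwE)
  then have "self_embedding G g"
    using g sub(1) by (auto simp: self_embedding_def bij_betw_def)
  with H(2) g show ?thesis by (auto simp: bij_betw_def)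
qed

lemma finite_missed:
  assumes "\<And>x. x \<in> verts G \<Longrightarrow> \<exists>f. self_embedding G f \<and> x \<notin> f ` verts G"
    and "finite T"
  shows "\<exists>f. self_embedding G f \<and> f ` verts G \<inter> T = {}"
  using assms(2)
proof (induction "card T" arbitrary: T rule: less_induct)
  case less
  show ?case
  proof (cases "T \<inter> verts G = {}")
    case True
    then show ?thesis using self_embedding_id[of G] by (intro exI[of _ id]) auto
  next
    case False
    then obtain x where x: "x \<in> T" "x \<in> verts G" by blast
    then obtain f where f: "self_embedding G f" "x \<notin> f ` verts G"
      using assms(1) by blast
    define T' where "T' = {u \<in> verts G. f u \<in> T}"
    have inj: "inj_on f T'"
      using f(1) by (auto simp: self_embedding_def T'_def inj_on_def)
    have im: "f ` T' \<subseteq> T - {x}"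
      using f(2) by (auto simp: T'_def)
    have fin: "finite T'"
      using inj im less.prems by (meson finite_Diff finite_imageD finite_subset)
    have "card T' \<le> card (T - {x})"
      using inj im less.prems by (simp add: card_inj_on_le)
    also have "\<dots> < card T"
      using less.prems x(1) by (rule card_Diff1_less)
    finally obtain h where h: "self_embedding G h" "h ` verts G \<inter> T' = {}"
      using less.hyps fin by blast
    \<comment> \<open>A vertex that \<open>f\<close> sends into \<open>T\<close> belongs to
      \<open>T'\<close>, which \<open>h\<close> avoids.\<close>
    have "(f \<circ> h) ` verts G \<inter> T = {}"
      using h by (auto simp: T'_def self_embedding_def)
    with self_embedding_comp[OF f(1) h(1)] show ?thesis by blast
  qed
qed

text \<open>Cut the walk at its last visit to \<open>v\<close>: the next vertex serves as
  \<open>w\<close>, and the remainder never meets \<open>v\<close>.\<close>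

lemma rtrancl_avoiding_start:
  assumes "(v, y) \<in> (adj_on G X)\<^sup>*"
  shows "y = v \<or> (\<exists>w. w \<in> X - {v} \<and> {v, w} \<in> edges G \<and> (w, y) \<in> (adj_on G (X - {v}))\<^sup>*)"
  using assms
proof (induction rule: rtrancl_induct)
  case (step y z)
  show ?case
  proof (cases "z = v \<or> y = v")
    case True
    then show ?thesis using step.hyps(2) by (auto simp: adj_on_def)
  next
    case False
    with step.IH obtain w where w: "w \<in> X - {v}" "{v, w} \<in> edges G"
      "(w, y) \<in> (adj_on G (X - {v}))\<^sup>*" by blast
    have "(y, z) \<in> adj_on G (X - {v})"
      using False step.hyps(2) by (auto simp: adj_on_def)
    with w show ?thesis by (meson rtrancl_into_rtrancl)
  qed
qed simp

text \<open>Each vertex on a walk from \<open>w\<close> is itself reachable from \<open>w\<close>,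
  so the walk never leaves the component. Hence the component is connected on its own.\<close>

lemma rtrancl_adj_on_component:
  assumes "(w, y) \<in> (adj_on G X)\<^sup>*"
  shows "(w, y) \<in> (adj_on G {z. (w, z) \<in> (adj_on G X)\<^sup>*})\<^sup>*"
  using assms
proof (induction rule: rtrancl_induct)
  case (step y z)
  have "(y, z) \<in> adj_on G {z. (w, z) \<in> (adj_on G X)\<^sup>*}"
    using step.hyps by (auto simp: adj_on_def intro: rtrancl_into_rtrancl)
  with step.IH show ?case by (rule rtrancl_into_rtrancl)
qed simp

lemma rtrancl_adj_on_mem:
  assumes "(w, y) \<in> (adj_on G X)\<^sup>*" "w \<in> X"
  shows "y \<in> X"
  using assms by (induction rule: rtrancl_induct) (auto simp: adj_on_def)

text \<open>The invariant of the greedy construction. Since \<open>adj_on\<close> is symmetric,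
  reachability from \<open>v\<close> alone expresses that \<open>X\<close> is connected.\<close>

definition ray_state :: "'a graph \<Rightarrow> 'a set \<Rightarrow> 'a \<Rightarrow> bool" where
  "ray_state G X v \<longleftrightarrow> X \<subseteq> verts G \<and> v \<in> X \<and> (\<forall>y \<in> X. (v, y) \<in> (adj_on G X)\<^sup>*) \<and>
     (\<exists>f. self_embedding G f \<and> f ` verts G \<subseteq> X)"

lemma ray_state_step:
  assumes con: "connected_graph G"
    and missed: "\<And>T. finite T \<Longrightarrow> \<exists>f. self_embedding G f \<and> f ` verts G \<inter> T = {}"
    and st: "ray_state G X v"
  shows "\<exists>C w. ray_state G C w \<and> C \<subseteq> X - {v} \<and> {v, w} \<in> edges G"
proof -
  from st obtain f where X: "X \<subseteq> verts G" "v \<in> X" "\<And>y. y \<in> X \<Longrightarrow> (v, y) \<in> (adj_on G X)\<^sup>*"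
    and f: "self_embedding G f" "f ` verts G \<subseteq> X"
    by (auto simp: ray_state_def)
  \<comment> \<open>An embedding that merely misses \<open>v\<close> could leave \<open>X\<close>.
    Missing the preimage of \<open>v\<close> first and then applying \<open>f\<close> both avoids
    \<open>v\<close> and stays in \<open>X\<close>.\<close>
  define T where "T = {u \<in> verts G. f u = v}"
  have "finite (f ` T)"
    by (rule finite_subset[of _ "{v}"]) (auto simp: T_def)
  moreover have "inj_on f T"
    using f(1) by (auto simp: self_embedding_def T_def inj_on_def)
  ultimately have "finite T" by (rule finite_imageD)
  then obtain h where h: "self_embedding G h" "h ` verts G \<inter> T = {}"
    using missed[of T] by blast
  define g where "g = f \<circ> h"
  have g: "self_embedding G g"
    unfolding g_def by (rule self_embedding_comp[OF f(1) h(1)])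
  have gX: "g ` verts G \<subseteq> X - {v}"
  proof clarify
    fix u assume "u \<in> verts G"
    then have "h u \<in> verts G" "h u \<notin> T"
      using h by (auto simp: self_embedding_def)
    then show "g u \<in> X - {v}"
      using f(2) by (auto simp: g_def T_def)
  qed
  \<comment> \<open>Any vertex will do: \<open>g a\<close> only marks the component of
    \<open>X - {v}\<close> that holds the copy of \<open>G\<close>.\<close>
  obtain a where a: "a \<in> verts G" using X by blast
  then have "g a \<in> X - {v}" using gX by blast
  then obtain w where w: "w \<in> X - {v}" "{v, w} \<in> edges G"
    "(w, g a) \<in> (adj_on G (X - {v}))\<^sup>*"
    using rtrancl_avoiding_start[OF X(3)] by blast
  define C where "C = {y. (w, y) \<in> (adj_on G (X - {v}))\<^sup>*}"
  have "C \<subseteq> X - {v}"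
    using rtrancl_adj_on_mem[OF _ w(1)] by (auto simp: C_def)
  moreover have "g ` verts G \<subseteq> C"
  proof clarify
    fix b assume "b \<in> verts G"
    then have "(g a, g b) \<in> (adj_on G (X - {v}))\<^sup>*"
      by (intro adj_on_rtrancl_image[OF _ g gX] connected_graph_rtrancl[OF con a])
    with w(3) show "g b \<in> C" by (auto simp: C_def)
  qed
  moreover have "(w, y) \<in> (adj_on G C)\<^sup>*" if "y \<in> C" for y
    using that unfolding C_def mem_Collect_eq by (rule rtrancl_adj_on_component)
  moreover have "w \<in> C" by (simp add: C_def)
  moreover have "C \<subseteq> verts G" using \<open>C \<subseteq> X - {v}\<close> X(1) by blast
  ultimately have "ray_state G C w"
    using g unfolding ray_state_def by (intro conjI ballI exI[of _ g])
  with \<open>C \<subseteq> X - {v}\<close> w(2) show ?thesis by blast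
qed

theorem theorem2p9:
  fixes G :: "'a graph"
  assumes "simple_graph G"
    and "connected_graph G"
    and "self_contained G"
    and "Fnd G = null_graph"
  shows "\<exists>r. is_ray G r"
proof -
  have missed: "\<exists>f. self_embedding G f \<and> f ` verts G \<inter> T = {}" if "finite T" for T
    using finite_missed[OF Fnd_null_missed[OF assms(4)] that] .
  obtain v0 where "v0 \<in> verts G"
    using assms(2) by (auto simp: connected_graph_def)
  then have "ray_state G (verts G) v0"
    unfolding ray_state_def
    using connected_graph_rtrancl[OF assms(2)] self_embedding_id[of G]
    by (auto intro!: exI[of _ id])
  then have ex: "\<exists>p. ray_state G (fst p) (snd p)" by auto
  have step: "\<exists>q. ray_state G (fst q) (snd q) \<and>
      (fst q \<subseteq> fst p - {snd p} \<and> {snd p, snd q} \<in> edges G)"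
    if p: "ray_state G (fst p) (snd p)" for p
  proof -
    obtain C w where "ray_state G C w" "C \<subseteq> fst p - {snd p}" "{snd p, w} \<in> edges G"
      using ray_state_step[OF assms(2) missed p] by blast
    then show ?thesis by (intro exI[of _ "(C, w)"]) simp
  qed
  \<comment> \<open>Dependent choice runs over pairs of a set and a vertex; the second components
    form the ray.\<close>
  have "\<exists>s. \<forall>n. ray_state G (fst (s n)) (snd (s n)) \<and>
      (fst (s (Suc n)) \<subseteq> fst (s n) - {snd (s n)} \<and> {snd (s n), snd (s (Suc n))} \<in> edges G)"
    by (rule dependent_nat_choice[where P = "\<lambda>_ p. ray_state G (fst p) (snd p)"
      and Q = "\<lambda>_ p q. fst q \<subseteq> fst p - {snd p} \<and> {snd p, snd q} \<in> edges G"])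
      (fact ex, fact step)
  then obtain s where st: "\<And>n. ray_state G (fst (s n)) (snd (s n))"
    and dec: "\<And>n. fst (s (Suc n)) \<subseteq> fst (s n) - {snd (s n)}"
    and edge: "\<And>n. {snd (s n), snd (s (Suc n))} \<in> edges G"
    by blast
  have mem: "snd (s n) \<in> fst (s n)" "fst (s n) \<subseteq> verts G" for n
    using st[of n] by (auto simp: ray_state_def)
  have mono: "fst (s n) \<subseteq> fst (s m)" if "m \<le> n" for m n
    by (rule lift_Suc_antimono_le[of "\<lambda>n. fst (s n)", OF _ that]) (use dec in blast)
  \<comment> \<open>The vertex chosen at stage \<open>m\<close> is deleted from the set at stage
    \<open>Suc m\<close>, and all later vertices lie in that set.\<close>
  have "snd (s m) \<noteq> snd (s n)" if "m < n" for m n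
    using mono[of "Suc m" n] dec[of m] mem(1)[of n] that by auto
  then have "inj (\<lambda>n. snd (s n))"
    by (intro injI) (metis linorder_neq_iff)
  then have "is_ray G (\<lambda>n. snd (s n))"
    using mem edge by (auto simp: is_ray_def)
  then show ?thesis by blast
qed

end
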